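(* If $\mathcal{A}$ is a bounded, irreducible family of subadditive, order-preserving, homogeneous maps $f:\mathbb{R}^n_{\ge0}\to\mathbb{R}^n_{\ge0}$ with generalized spectral radius $r(\mathcal{A})=1$, then the semigroup $\mathcal{A}^+$ is bounded.
   Context: $\mathbb{R}^n_{\ge0}$ is the standard cone of vectors with nonnegative entries in $\mathbb{R}^n$ (with a fixed norm $\|\cdot\|$), and $x\ge y$ means $x-y\in\mathbb{R}^n_{\ge0}$. A map $f$ is order-preserving if $f(x)\ge f(y)$ whenever $x\ge y$, homogeneous if $f(cx)=cf(x)$ for all $c>0$, and subadditive if $f(x+y)\le f(x)+f(y)$ for all $x,y$. (Order-preserving, homogeneous, subadditive self-maps of $\mathbb{R}^n_{\ge 0}$ are automatically continuous.) $\|f\|:=\sup\{\|f(x)\| : x\in\mathbb{R}^n_{\ge0}, \|x\|=1\}$; a family $\mathcal{F}$ of homogeneous maps is bounded if $\{\|f\| : f\in\mathcal{F}\}$ is bounded. For a homogeneous self-map $f$ with $\|f\|<\infty$, $r(f):=\lim_{k\to\infty}\|f^k\|^{1/k}=\inf_{k>0}\|f^k\|^{1/k}$. For $m\ge1$, $\mathcal{A}^m:=\{f_m\circ\cdots\circ f_1 : f_i\in\mathcal{A}\}$, and $\mathcal{A}^+:=\bigcup_{m>0}\mathcal{A}^m$. The generalized spectral radius is $r(\mathcal{A}):=\limsup_{m\to\infty}\sup_{f\in\mathcal{A}^m}r(f)^{1/m}=\sup_{m>0}\sup_{f\in\mathcal{A}^m}r(f)^{1/m}$. $\mathcal{A}$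 is irreducible if there is no non-trivial closed face $F$ of the cone $\mathbb{R}^n_{\ge0}$ (i.e. no face other than $\{0\}$ and $\mathbb{R}^n_{\ge0}$) that is invariant for all $f\in\mathcal{A}$ (i.e. $f(F)\subseteq F$ for all $f\in\mathcal{A}$). *)

theory Defs
  imports "HOL-Analysis.Analysis"
begin

definition nonneg_cone :: "(real ^ 'n) set"
  where "nonneg_cone = {x. 0 \<le> x}"

lemma mem_nonneg_cone_iff: "x \<in> nonneg_cone \<longleftrightarrow> (\<forall>i. 0 \<le> x $ i)"
  by (simp add: nonneg_cone_def less_eq_vec_def)

text \<open>The library order on \<^typ>\<open>real ^ 'n\<close> is the order induced by the cone.\<close>

lemma le_iff_diff_mem_nonneg_cone: "y \<le> x \<longleftrightarrow> x - y \<in> nonneg_cone"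
  by (simp add: nonneg_cone_def)

text \<open>
  The norm is a parameter, so that it need not be the Euclidean norm of the type class.
\<close>

definition is_norm :: "('a::real_vector \<Rightarrow> real) \<Rightarrow> bool"
  where "is_norm N \<longleftrightarrow>
    (\<forall>x. 0 \<le> N x) \<and>
    (\<forall>x. N x = 0 \<longleftrightarrow> x = 0) \<and>
    (\<forall>c x. N (c *\<^sub>R x) = \<bar>c\<bar> * N x) \<and>
    (\<forall>x y. N (x + y) \<le> N x + N y)"

text \<open>
  A self-map of the cone is represented by a total function; every notion below depends
  only on its values on the cone.
\<close>

definition cone_self_map :: "(real ^ 'n \<Rightarrow> real ^ 'n) \<Rightarrow> bool"
  where "cone_self_map f \<longleftrightarrow> f \<in> nonneg_cone \<rightarrow> nonneg_cone"

definition cone_order_preserving :: "(real ^ 'n \<Rightarrow> real ^ 'n) \<Rightarrow> bool"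
  where "cone_order_preserving f \<longleftrightarrow> mono_on nonneg_cone f"

definition cone_homogeneous :: "(real ^ 'n \<Rightarrow> real ^ 'n) \<Rightarrow> bool"
  where "cone_homogeneous f \<longleftrightarrow> (\<forall>x\<in>nonneg_cone. \<forall>c>0. f (c *\<^sub>R x) = c *\<^sub>R f x)"

definition cone_subadditive :: "(real ^ 'n \<Rightarrow> real ^ 'n) \<Rightarrow> bool"
  where "cone_subadditive f \<longleftrightarrow> (\<forall>x\<in>nonneg_cone. \<forall>y\<in>nonneg_cone. f (x + y) \<le> f x + f y)"

text \<open>Extended-real valued, so that the supremum is meaningful even when it is infinite.\<close>

definition cone_norm :: "(real ^ 'n \<Rightarrow> real) \<Rightarrow> (real ^ 'n \<Rightarrow> real ^ 'n) \<Rightarrow> ereal"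
  where "cone_norm N f = (SUP x\<in>{x \<in> nonneg_cone. N x = 1}. ereal (N (f x)))"

definition bounded_family :: "(real ^ 'n \<Rightarrow> real) \<Rightarrow> (real ^ 'n \<Rightarrow> real ^ 'n) set \<Rightarrow> bool"
  where "bounded_family N F \<longleftrightarrow> (\<exists>C::real. \<forall>f\<in>F. cone_norm N f \<le> ereal C)"

text \<open>
  Only meaningful for homogeneous self-maps of finite \<^const>\<open>cone_norm\<close>, for which all
  iterates have finite norm (so \<^const>\<open>real_of_ereal\<close> is harmless) and the limit exists.
\<close>

definition cone_spectral_radius :: "(real ^ 'n \<Rightarrow> real) \<Rightarrow> (real ^ 'n \<Rightarrow> real ^ 'n) \<Rightarrow> real"
  where "cone_spectral_radius N f = lim (\<lambda>k. root k (real_of_ereal (cone_norm N (f ^^ k))))"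

definition family_power :: "('a \<Rightarrow> 'a) set \<Rightarrow> nat \<Rightarrow> ('a \<Rightarrow> 'a) set"
  where "family_power A m = {foldr (\<circ>) fs id | fs. length fs = m \<and> set fs \<subseteq> A}"

definition generated_semigroup :: "('a \<Rightarrow> 'a) set \<Rightarrow> ('a \<Rightarrow> 'a) set"
  where "generated_semigroup A = (\<Union>m\<in>{m. m > 0}. family_power A m)"

definition generalized_spectral_radius ::
    "(real ^ 'n \<Rightarrow> real) \<Rightarrow> (real ^ 'n \<Rightarrow> real ^ 'n) set \<Rightarrow> ereal"
  where "generalized_spectral_radius N A =
    limsup (\<lambda>m. SUP f\<in>family_power A m. ereal (root m (cone_spectral_radius N f)))"

text \<open>
  The library's \<^const>\<open>face_of\<close> admits the empty set, which has to be excluded here: it is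
  invariant under every map. The nonempty faces are the faces in the sense of cones.
\<close>

definition irreducible_family :: "(real ^ 'n \<Rightarrow> real ^ 'n) set \<Rightarrow> bool"
  where "irreducible_family A \<longleftrightarrow>
    \<not> (\<exists>F. F face_of nonneg_cone \<and> closed F \<and> F \<noteq> {} \<and> F \<noteq> {0} \<and> F \<noteq> nonneg_cone \<and>
           (\<forall>f\<in>A. f ` F \<subseteq> F))"

end

theory Submission imports Defs begin

text \<open>
  Write \<open>f\<^sub>i\<^sub>j\<close> for the \<open>i\<close>-th coordinate of \<open>f e\<^sub>j\<close>, where \<open>e\<^sub>j\<close> is the \<open>j\<close>-th unit vector. Although the
  maps are not linear, this matrix controls them: subadditivity gives
  \<open>f(x)\<^sub>i \<le> \<Sum>\<^sub>j x\<^sub>j f\<^sub>i\<^sub>j\<close> (\<open>coord_le_sum_entry\<close>), so a family is bounded as soon as its entries are, while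
  monotonicity gives \<open>(g \<circ> f)\<^sub>i\<^sub>j \<ge> g\<^sub>i\<^sub>k f\<^sub>k\<^sub>j\<close> (\<open>entry_mult_le_entry_comp\<close>), so diagonal entries of
  powers grow geometrically and \<open>f\<^sub>j\<^sub>j \<le> r(f)\<close> (\<open>diagonal_entry_le_spectral_radius\<close>).

  The closed faces of the cone are its coordinate subcones, and the coordinates that are reachable
  from \<open>j\<close> by positive entries of products span an invariant one. Irreducibility therefore supplies,
  for all \<open>i\<close> and \<open>j\<close>, a product \<open>h\<close> of maps of the family with \<open>h\<^sub>j\<^sub>i > 0\<close>
  (\<open>irreducible_imp_positive_entry\<close>). If \<open>f\<close> is any member of the semigroup, then so is \<open>h \<circ> f\<close>, and
  \<open>h\<^sub>j\<^sub>i f\<^sub>i\<^sub>j \<le> (h \<circ> f)\<^sub>j\<^sub>j \<le> 1\<close>, because a diagonal entry above \<open>1\<close> would push the generalized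
  spectral radius above \<open>1\<close> (\<open>root_diagonal_entry_le_generalized_spectral_radius\<close>). Hence
  \<open>f\<^sub>i\<^sub>j \<le> 1 / h\<^sub>j\<^sub>i\<close>, a bound that does not depend on \<open>f\<close>; there are only finitely many pairs \<open>i, j\<close>.
\<close>

section \<open>Sublinear maps of the cone and their entries\<close>

definition cone_sublinear :: "(real ^ 'n \<Rightarrow> real ^ 'n) \<Rightarrow> bool"
  where "cone_sublinear f \<longleftrightarrow>
    cone_self_map f \<and> cone_subadditive f \<and> cone_order_preserving f \<and> cone_homogeneous f"

definition entry :: "(real ^ 'n \<Rightarrow> real ^ 'n) \<Rightarrow> 'n \<Rightarrow> 'n \<Rightarrow> real"
  where "entry f i j = f (axis j 1) $ i"

lemma axis_in_cone: "axis j 1 \<in> nonneg_cone"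
  by (simp add: mem_nonneg_cone_iff axis_def)

lemma scaleR_in_cone: "x \<in> nonneg_cone \<Longrightarrow> 0 \<le> c \<Longrightarrow> c *\<^sub>R x \<in> nonneg_cone"
  by (simp add: mem_nonneg_cone_iff)

lemma add_in_cone: "x \<in> nonneg_cone \<Longrightarrow> y \<in> nonneg_cone \<Longrightarrow> x + y \<in> nonneg_cone"
  by (simp add: mem_nonneg_cone_iff)

lemma zero_in_cone: "0 \<in> nonneg_cone"
  by (simp add: mem_nonneg_cone_iff)

lemma sublinear_in_cone: "cone_sublinear f \<Longrightarrow> x \<in> nonneg_cone \<Longrightarrow> f x \<in> nonneg_cone"
  by (auto simp: cone_sublinear_def cone_self_map_def)

lemma sublinear_add_le:
  "cone_sublinear f \<Longrightarrow> x \<in> nonneg_cone \<Longrightarrow> y \<in> nonneg_cone \<Longrightarrow> f (x + y) \<le> f x + f y"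
  by (auto simp: cone_sublinear_def cone_subadditive_def)

lemma sublinear_mono:
  "cone_sublinear f \<Longrightarrow> x \<in> nonneg_cone \<Longrightarrow> y \<in> nonneg_cone \<Longrightarrow> x \<le> y \<Longrightarrow> f x \<le> f y"
  by (auto simp: cone_sublinear_def cone_order_preserving_def mono_on_def)

lemma sublinear_zero:
  assumes "cone_sublinear f" shows "f 0 = 0"
proof -
  have "f ((2::real) *\<^sub>R 0) = (2::real) *\<^sub>R f 0"
    using assms zero_in_cone unfolding cone_sublinear_def cone_homogeneous_def
    by (metis zero_less_numeral)
  then have "f 0 = (2::real) *\<^sub>R f 0" by simp
  then show ?thesis by (simp add: scaleR_2)
qed

lemma sublinear_scaleR:
  assumes "cone_sublinear f" "x \<in> nonneg_cone" "0 \<le> c"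
  shows "f (c *\<^sub>R x) = c *\<^sub>R f x"
proof (cases "c = 0")
  case True
  then show ?thesis using sublinear_zero[OF assms(1)] by simp
next
  case False
  then show ?thesis using assms by (simp add: cone_sublinear_def cone_homogeneous_def)
qed

lemma sublinear_id: "cone_sublinear id"
  by (auto simp: cone_sublinear_def cone_self_map_def cone_subadditive_def
      cone_order_preserving_def cone_homogeneous_def mono_on_def)

lemma sublinear_comp:
  assumes f: "cone_sublinear f" and g: "cone_sublinear g"
  shows "cone_sublinear (g \<circ> f)"
  unfolding cone_sublinear_def
proof (intro conjI)
  note fc = sublinear_in_cone[OF f]
  show "cone_self_map (g \<circ> f)"
    using fc sublinear_in_cone[OF g] by (auto simp: cone_self_map_def)
  show "cone_subadditive (g \<circ> f)"
    unfolding cone_subadditive_def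
  proof (intro ballI)
    fix x y :: "real ^ 'a" assume xy: "x \<in> nonneg_cone" "y \<in> nonneg_cone"
    have "g (f (x + y)) \<le> g (f x + f y)"
      using xy by (intro sublinear_mono[OF g] sublinear_add_le[OF f] fc add_in_cone)
    also have "\<dots> \<le> g (f x) + g (f y)"
      using xy by (intro sublinear_add_le[OF g] fc)
    finally show "(g \<circ> f) (x + y) \<le> (g \<circ> f) x + (g \<circ> f) y" by simp
  qed
  show "cone_order_preserving (g \<circ> f)"
    unfolding cone_order_preserving_def
    by (auto intro!: mono_onI sublinear_mono[OF g] sublinear_mono[OF f] fc)
  show "cone_homogeneous (g \<circ> f)"
    unfolding cone_homogeneous_def
    by (simp add: sublinear_scaleR[OF f] sublinear_scaleR[OF g] fc)
qed

lemma sublinear_funpow: "cone_sublinear f \<Longrightarrow> cone_sublinear (f ^^ k)"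
  by (induction k) (auto intro: sublinear_id sublinear_comp)

lemma entry_nonneg: "cone_sublinear f \<Longrightarrow> 0 \<le> entry f i j"
  using sublinear_in_cone[OF _ axis_in_cone] by (auto simp: entry_def mem_nonneg_cone_iff)

text \<open>
  The vector \<open>f e\<^sub>j\<close> dominates each of its components \<open>f\<^sub>k\<^sub>j e\<^sub>k\<close>, and \<open>g\<close> preserves the order and
  scales. For linear maps this is the estimate of a sum of nonnegative terms by one of them.
\<close>

lemma entry_mult_le_entry_comp:
  assumes f: "cone_sublinear f" and g: "cone_sublinear g"
  shows "entry g i k * entry f k j \<le> entry (g \<circ> f) i j"
proof -
  let ?c = "entry f k j"
  have c: "0 \<le> ?c" by (rule entry_nonneg[OF f])
  have fj: "f (axis j 1) \<in> nonneg_cone" by (rule sublinear_in_cone[OF f axis_in_cone])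
  have "?c *\<^sub>R axis k 1 \<le> f (axis j 1)"
    using fj by (auto simp: less_eq_vec_def axis_def entry_def mem_nonneg_cone_iff)
  then have "g (?c *\<^sub>R axis k 1) \<le> g (f (axis j 1))"
    by (intro sublinear_mono[OF g] fj scaleR_in_cone axis_in_cone c)
  then have "?c *\<^sub>R g (axis k 1) \<le> g (f (axis j 1))"
    by (simp add: sublinear_scaleR[OF g axis_in_cone c])
  then show ?thesis by (auto simp: less_eq_vec_def entry_def mult.commute)
qed

lemma diagonal_entry_power_le:
  assumes "cone_sublinear f"
  shows "entry f j j ^ k \<le> entry (f ^^ k) j j"
proof (induction k)
  case 0
  show ?case by (simp add: entry_def)
next
  case (Suc k)
  have "entry f j j ^ Suc k \<le> entry f j j * entry (f ^^ k) j j"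
    using Suc entry_nonneg[OF assms] by (simp add: mult_left_mono)
  also have "\<dots> \<le> entry (f ^^ Suc k) j j"
    using entry_mult_le_entry_comp[OF sublinear_funpow[OF assms] assms] by simp
  finally show ?case .
qed

lemma sublinear_sum_le:
  assumes f: "cone_sublinear f" and "finite S" and "\<And>j. j \<in> S \<Longrightarrow> v j \<in> nonneg_cone"
  shows "(\<Sum>j\<in>S. v j) \<in> nonneg_cone \<and> f (\<Sum>j\<in>S. v j) \<le> (\<Sum>j\<in>S. f (v j))"
  using assms(2,3)
proof (induction S rule: finite_induct)
  case empty
  show ?case by (simp add: zero_in_cone sublinear_zero[OF f])
next
  case (insert a S)
  then have IH: "sum v S \<in> nonneg_cone" "f (sum v S) \<le> (\<Sum>j\<in>S. f (v j))"
    and a: "v a \<in> nonneg_cone" by auto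
  have "f (v a + sum v S) \<le> f (v a) + f (sum v S)"
    by (rule sublinear_add_le[OF f a IH(1)])
  also have "\<dots> \<le> f (v a) + (\<Sum>j\<in>S. f (v j))" using IH(2) by simp
  finally show ?case using insert.hyps add_in_cone[OF a IH(1)] by simp
qed

text \<open>Split \<open>x\<close> into its components \<open>x\<^sub>j e\<^sub>j\<close> and use subadditivity.\<close>

lemma coord_le_sum_entry:
  assumes f: "cone_sublinear f" and x: "x \<in> nonneg_cone"
  shows "f x $ i \<le> (\<Sum>j\<in>UNIV. x $ j * entry f i j)"
proof -
  have x0: "0 \<le> x $ j" for j using x by (simp add: mem_nonneg_cone_iff)
  have "f (\<Sum>j\<in>UNIV. x $ j *\<^sub>R axis j 1) \<le> (\<Sum>j\<in>UNIV. f (x $ j *\<^sub>R axis j 1))"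
    using sublinear_sum_le[OF f, of UNIV "\<lambda>j. x $ j *\<^sub>R axis j 1"]
    by (simp add: scaleR_in_cone axis_in_cone x0)
  moreover have "(\<Sum>j\<in>UNIV. x $ j *\<^sub>R axis j 1) = x"
    using basis_expansion[of x] by (simp add: scalar_mult_eq_scaleR)
  moreover have "(\<Sum>j\<in>UNIV. f (x $ j *\<^sub>R axis j 1)) = (\<Sum>j\<in>UNIV. x $ j *\<^sub>R f (axis j 1))"
    by (simp add: sublinear_scaleR[OF f axis_in_cone x0])
  ultimately have "f x \<le> (\<Sum>j\<in>UNIV. x $ j *\<^sub>R f (axis j 1))" by simp
  then show ?thesis by (simp add: less_eq_vec_def entry_def)
qed

section \<open>Norms on the cone\<close>

text \<open>
  The upper constant comes from expanding \<open>x\<close> in unit vectors. It makes \<open>N\<close> continuous, so \<open>N\<close> attains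
  a minimum on the compact Euclidean unit sphere, and this minimum is the lower constant.
\<close>

lemma is_norm_equivalent_norm:
  fixes N :: "real ^ 'n \<Rightarrow> real"
  assumes N: "is_norm N"
  obtains c C where "0 < c" "0 < C" "\<And>x. c * norm x \<le> N x" "\<And>x. N x \<le> C * norm x"
proof -
  have Npos: "0 \<le> N x" and N0: "N x = 0 \<longleftrightarrow> x = 0" and Nsc: "N (a *\<^sub>R x) = \<bar>a\<bar> * N x"
    and Ntri: "N (x + y) \<le> N x + N y" for x y a
    using N by (auto simp: is_norm_def)
  have Nsum: "N (sum v S) \<le> (\<Sum>j\<in>S. N (v j))" if "finite S" for S :: "'n set" and v
    using that
  proof (induction S rule: finite_induct)
    case empty
    show ?case using N0[of 0] by simp
  next
    case (insert a S)
    then show ?case using Ntri[of "v a" "sum v S"] by simp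
  qed
  define C where "C = (\<Sum>j\<in>UNIV. N (axis j (1::real))) + 1"
  have C: "0 < C" unfolding C_def by (simp add: Npos sum_nonneg add_nonneg_pos)
  have upper: "N x \<le> C * norm x" for x
  proof -
    have "x = (\<Sum>j\<in>UNIV. x $ j *\<^sub>R axis j 1)"
      using basis_expansion[of x] by (simp add: scalar_mult_eq_scaleR)
    then have "N x \<le> (\<Sum>j\<in>UNIV. \<bar>x $ j\<bar> * N (axis j 1))"
      using Nsum[of UNIV "\<lambda>j. x $ j *\<^sub>R axis j 1"] by (simp add: Nsc)
    also have "\<dots> \<le> (\<Sum>j\<in>UNIV. norm x * N (axis j 1))"
      by (intro sum_mono mult_right_mono component_le_norm_cart Npos)
    also have "\<dots> \<le> C * norm x"
      by (simp add: C_def sum_distrib_left[symmetric] algebra_simps)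
    finally show ?thesis .
  qed
  have lip: "\<bar>N x - N y\<bar> \<le> C * norm (x - y)" for x y
  proof -
    have "N (y - x) = N (x - y)" using Nsc[of "-1" "x - y"] by simp
    then show ?thesis
      using Ntri[of "x - y" y] Ntri[of "y - x" x] upper[of "x - y"] by simp
  qed
  have cont: "continuous_on (sphere 0 1) N"
  proof (rule lipschitz_on_continuous_on)
    show "C-lipschitz_on (sphere 0 1) N"
      using lip C by (intro lipschitz_onI) (auto simp: dist_norm)
  qed
  have "sphere (0::real ^ 'n) 1 \<noteq> {}" by simp
  then obtain z where z: "z \<in> sphere 0 1" "\<And>y. y \<in> sphere 0 1 \<Longrightarrow> N z \<le> N y"
    using continuous_attains_inf[OF compact_sphere _ cont] by metis
  have "z \<noteq> 0" using z(1) by auto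
  then have zpos: "0 < N z" using Npos[of z] N0[of z] by linarith
  have lower: "N z * norm x \<le> N x" for x
  proof (cases "x = 0")
    case True
    then show ?thesis using Npos by simp
  next
    case False
    then have "N z \<le> N ((1 / norm x) *\<^sub>R x)" by (intro z(2)) simp
    then show ?thesis using False unfolding Nsc by (simp add: field_simps)
  qed
  show ?thesis by (rule that[OF zpos C lower upper])
qed

text \<open>
  On \<open>{x. N x = 1}\<close> the coordinates are bounded by norm equivalence, so \<open>f(x)\<^sub>i \<le> \<Sum>\<^sub>j x\<^sub>j f\<^sub>i\<^sub>j\<close> bounds
  \<open>f x\<close>. The constant is the same for all maps, so that the bound applies to families.
\<close>

lemma cone_norm_le_entries:
  fixes N :: "real ^ 'n \<Rightarrow> real"
  assumes N: "is_norm N"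
  obtains K where
    "\<And>f M. cone_sublinear f \<Longrightarrow> (\<And>i j. entry f i j \<le> M) \<Longrightarrow> cone_norm N f \<le> ereal (K * M)"
proof -
  obtain c C where cC: "0 < c" "0 < C" and low: "\<And>x. c * norm x \<le> N x"
    and up: "\<And>x. N x \<le> C * norm x"
    using is_norm_equivalent_norm[OF N] by blast
  let ?n = "real CARD('n)"
  show ?thesis
  proof (rule that)
    fix f :: "real ^ 'n \<Rightarrow> real ^ 'n" and M
    assume f: "cone_sublinear f" and M: "\<And>i j. entry f i j \<le> M"
    show "cone_norm N f \<le> ereal (C * ?n * ?n / c * M)"
      unfolding cone_norm_def
    proof (rule SUP_least)
      fix x assume "x \<in> {x \<in> nonneg_cone. N x = 1}"
      then have x: "x \<in> nonneg_cone" "N x = 1" by auto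
      have nx: "norm x \<le> 1 / c" using low[of x] x(2) cC by (simp add: field_simps)
      have xj: "0 \<le> x $ j" "x $ j \<le> 1 / c" for j
        using x(1) component_le_norm_cart[of x j] nx by (auto simp: mem_nonneg_cone_iff)
      have fx: "0 \<le> f x $ i" for i
        using sublinear_in_cone[OF f x(1)] by (simp add: mem_nonneg_cone_iff)
      have "f x $ i \<le> ?n * (1 / c * M)" for i
      proof -
        have "f x $ i \<le> (\<Sum>j\<in>UNIV. x $ j * entry f i j)" by (rule coord_le_sum_entry[OF f x(1)])
        also have "\<dots> \<le> (\<Sum>j\<in>(UNIV::'n set). 1 / c * M)"
          using xj cC by (intro sum_mono mult_mono M entry_nonneg[OF f]) auto
        finally show ?thesis by simp
      qed
      then have "(\<Sum>i\<in>UNIV. \<bar>f x $ i\<bar>) \<le> (\<Sum>i\<in>(UNIV::'n set). ?n * (1 / c * M))"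
        using fx by (intro sum_mono) simp
      then have "norm (f x) \<le> ?n * (?n * (1 / c * M))"
        using norm_le_l1_cart[of "f x"] by simp
      then have "C * norm (f x) \<le> C * (?n * (?n * (1 / c * M)))"
        using cC by (intro mult_left_mono) auto
      then show "ereal (N (f x)) \<le> ereal (C * ?n * ?n / c * M)"
        using up[of "f x"] by (simp add: algebra_simps)
    qed
  qed
qed

text \<open>A sublinear map has only finitely many entries, so the preceding bound applies to it.\<close>

lemma sublinear_cone_norm_finite:
  fixes N :: "real ^ 'n \<Rightarrow> real"
  assumes N: "is_norm N" and f: "cone_sublinear f"
  shows "ereal (real_of_ereal (cone_norm N f)) = cone_norm N f"
    and "0 \<le> real_of_ereal (cone_norm N f)"
proof -
  obtain K where K: "\<And>f M. cone_sublinear f \<Longrightarrow> (\<And>i j. entry f i j \<le> M) \<Longrightarrow>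
      cone_norm N f \<le> ereal (K * M)"
    by (rule cone_norm_le_entries[OF N]) blast
  have "entry f i j \<le> (\<Sum>i\<in>UNIV. \<Sum>j\<in>UNIV. entry f i j)" for i j
  proof -
    have "entry f i j \<le> (\<Sum>j\<in>UNIV. entry f i j)"
      by (rule member_le_sum) (auto simp: entry_nonneg[OF f])
    also have "\<dots> \<le> (\<Sum>i\<in>UNIV. \<Sum>j\<in>UNIV. entry f i j)"
      by (rule member_le_sum) (auto simp: entry_nonneg[OF f] sum_nonneg)
    finally show ?thesis .
  qed
  then have fin: "cone_norm N f \<noteq> \<infinity>" using K[OF f] by fastforce
  fix j :: 'n
  let ?v = "(1 / N (axis j 1)) *\<^sub>R (axis j 1 :: real ^ 'n)"
  have pos: "0 < N (axis j (1::real))"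
    using N unfolding is_norm_def by (metis axis_eq_0_iff less_eq_real_def zero_neq_one)
  then have "N ?v = 1" using N by (simp add: is_norm_def)
  moreover have "?v \<in> nonneg_cone" using pos by (intro scaleR_in_cone axis_in_cone) simp
  ultimately have "ereal (N (f ?v)) \<le> cone_norm N f"
    unfolding cone_norm_def by (intro SUP_upper) simp
  moreover have "0 \<le> N (f ?v)" using N by (simp add: is_norm_def)
  ultimately have nonneg: "0 \<le> cone_norm N f" by (meson ereal_less_eq(5) order_trans)
  show "ereal (real_of_ereal (cone_norm N f)) = cone_norm N f"
    using fin nonneg by (intro ereal_real') auto
  show "0 \<le> real_of_ereal (cone_norm N f)"
    using nonneg by (rule real_of_ereal_pos)
qed

lemma norm_apply_le_cone_norm:
  assumes N: "is_norm N" and f: "cone_sublinear f" and x: "x \<in> nonneg_cone"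
  shows "N (f x) \<le> real_of_ereal (cone_norm N f) * N x"
proof (cases "x = 0")
  case True
  have "N 0 = 0" using N by (simp add: is_norm_def)
  then show ?thesis using True sublinear_zero[OF f] by simp
next
  case False
  let ?v = "(1 / N x) *\<^sub>R x"
  have pos: "0 < N x" using N False unfolding is_norm_def by (metis less_eq_real_def)
  then have "N ?v = 1" using N False by (simp add: is_norm_def)
  moreover have "?v \<in> nonneg_cone" using pos by (intro scaleR_in_cone x) simp
  ultimately have "ereal (N (f ?v)) \<le> cone_norm N f"
    unfolding cone_norm_def by (intro SUP_upper) simp
  then have "N (f ?v) \<le> real_of_ereal (cone_norm N f)"
    using sublinear_cone_norm_finite(1)[OF N f] by (metis ereal_less_eq(3))
  moreover have "N (f ?v) = N (f x) / N x"
    using N pos by (simp add: sublinear_scaleR[OF f x] is_norm_def)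
  ultimately show ?thesis using pos by (simp add: field_simps)
qed

lemma cone_norm_comp_le:
  assumes N: "is_norm N" and f: "cone_sublinear f" and g: "cone_sublinear g"
  shows "real_of_ereal (cone_norm N (g \<circ> f))
    \<le> real_of_ereal (cone_norm N g) * real_of_ereal (cone_norm N f)"
proof -
  have "cone_norm N (g \<circ> f)
      \<le> ereal (real_of_ereal (cone_norm N g) * real_of_ereal (cone_norm N f))"
    unfolding cone_norm_def[of N "g \<circ> f"]
  proof (rule SUP_least)
    fix x assume "x \<in> {x \<in> nonneg_cone. N x = 1}"
    then have x: "x \<in> nonneg_cone" "N x = 1" by auto
    have "N (g (f x)) \<le> real_of_ereal (cone_norm N g) * N (f x)"
      by (rule norm_apply_le_cone_norm[OF N g sublinear_in_cone[OF f x(1)]])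
    also have "\<dots> \<le> real_of_ereal (cone_norm N g) * real_of_ereal (cone_norm N f)"
      using norm_apply_le_cone_norm[OF N f x(1)] x(2) sublinear_cone_norm_finite(2)[OF N g]
      by (intro mult_left_mono) auto
    finally show "ereal (N ((g \<circ> f) x))
      \<le> ereal (real_of_ereal (cone_norm N g) * real_of_ereal (cone_norm N f))" by simp
  qed
  then show ?thesis
    using sublinear_cone_norm_finite(1)[OF N sublinear_comp[OF f g]] by (metis ereal_less_eq(3))
qed

section \<open>The spectral radius dominates diagonal entries\<close>

text \<open>
  Fekete's lemma in multiplicative form; the limit is \<open>L = inf {root m (u m) | m > 0}\<close>. For
  \<open>b > root m (u m)\<close>, splitting off blocks of length \<open>m\<close> bounds \<open>u n\<close> by a constant multiple of \<open>b ^ n\<close>,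
  and the constant disappears under the \<open>n\<close>-th root.
\<close>

lemma submultiplicative_root_convergent:
  fixes u :: "nat \<Rightarrow> real"
  assumes nonneg: "\<And>n. 0 \<le> u n" and sub: "\<And>m n. u (m + n) \<le> u m * u n"
  shows "convergent (\<lambda>n. root n (u n))"
proof -
  define L where "L = (INF n\<in>{0<..}. root n (u n))"
  have bdd: "bdd_below ((\<lambda>n. root n (u n)) ` {0<..})"
    by (rule bdd_belowI2[of _ 0]) (simp add: nonneg)
  have lower: "L \<le> root n (u n)" if "0 < n" for n
    unfolding L_def by (rule cINF_lower[OF bdd]) (use that in simp)
  have "(\<lambda>n. root n (u n)) \<longlonglongrightarrow> L"
  proof (rule order_tendstoI)
    fix a assume "a < L"
    then show "\<forall>\<^sub>F n in sequentially. a < root n (u n)"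
      by (intro eventually_sequentiallyI[of 1] less_le_trans[OF _ lower]) auto
  next
    fix a assume "L < a"
    then obtain m where m: "0 < m" "root m (u m) < a"
      unfolding L_def using cINF_less_iff[OF _ bdd, of a] by auto
    obtain b where b: "root m (u m) < b" "b < a" using dense[OF m(2)] by blast
    have b0: "0 < b" using b(1) nonneg[of m] m(1) by (meson le_less_trans real_root_ge_zero)
    have um: "u m \<le> b ^ m"
      using b(1) m(1) nonneg[of m] real_root_pow_pos2[of m "u m"]
        power_mono[of "root m (u m)" b m] by (simp add: real_root_ge_zero)
    define K where "K = (\<Sum>r<m. u r / b ^ r) + 1"
    have K: "0 < K" unfolding K_def using nonneg b0 by (intro add_nonneg_pos sum_nonneg) auto
    have bound: "u n \<le> K * b ^ n" for n
    proof (induction n rule: less_induct)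
      case (less n)
      show ?case
      proof (cases "n < m")
        case True
        then have "u n / b ^ n \<le> (\<Sum>r<m. u r / b ^ r)"
          using nonneg b0 by (intro member_le_sum) auto
        then have "u n / b ^ n \<le> K" unfolding K_def by simp
        then show ?thesis using b0 by (simp add: field_simps)
      next
        case False
        then have "u n \<le> u m * u (n - m)" using sub[of m "n - m"] by simp
        also have "\<dots> \<le> b ^ m * (K * b ^ (n - m))"
          using um less[of "n - m"] False m(1) nonneg b0 by (intro mult_mono) auto
        also have "\<dots> = K * b ^ n" using False by (simp flip: power_add)
        finally show ?thesis .
      qed
    qed
    have "(\<lambda>n. root n K * b) \<longlonglongrightarrow> 1 * b"
      by (intro tendsto_mult LIMSEQ_root_const[OF K] tendsto_const)
    then have "\<forall>\<^sub>F n in sequentially. root n K * b < a"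
      using b(2) by (intro order_tendstoD(2)) auto
    then show "\<forall>\<^sub>F n in sequentially. root n (u n) < a"
      using eventually_gt_at_top[of 0]
    proof eventually_elim
      case (elim n)
      have "root n (u n) \<le> root n (K * b ^ n)"
        using bound elim by (intro real_root_le_mono) auto
      also have "\<dots> = root n K * b"
        using elim b0 by (simp add: real_root_mult real_root_power_cancel)
      finally show ?case using elim by simp
    qed
  qed
  then show ?thesis by (auto simp: convergent_def)
qed

text \<open>
  The powers satisfy \<open>(f\<^sup>k)\<^sub>j\<^sub>j \<ge> (f\<^sub>j\<^sub>j)\<^sup>k\<close>, and the norm of \<open>f\<^sup>k\<close> is at least a fixed positive multiple of
  this entry; the multiple disappears under the \<open>k\<close>-th root.
\<close>

lemma diagonal_entry_le_spectral_radius: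
  fixes N :: "real ^ 'n \<Rightarrow> real"
  assumes N: "is_norm N" and f: "cone_sublinear f"
  shows "entry f j j \<le> cone_spectral_radius N f"
proof -
  define u where "u k = real_of_ereal (cone_norm N (f ^^ k))" for k
  note fk = sublinear_funpow[OF f]
  obtain c C where cC: "0 < c" "0 < C" and low: "\<And>x. c * norm x \<le> N x"
    and up: "\<And>x. N x \<le> C * norm x"
    using is_norm_equivalent_norm[OF N] by blast
  have u0: "0 \<le> u k" for k
    unfolding u_def by (rule sublinear_cone_norm_finite(2)[OF N fk])
  have "convergent (\<lambda>k. root k (u k))"
  proof (rule submultiplicative_root_convergent[OF u0])
    show "u (m + n) \<le> u m * u n" for m n
      unfolding u_def funpow_add by (rule cone_norm_comp_le[OF N fk fk])
  qed
  then have lim: "(\<lambda>k. root k (u k)) \<longlonglongrightarrow> cone_spectral_radius N f"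
    unfolding cone_spectral_radius_def u_def convergent_LIMSEQ_iff .
  have ujj: "c / C * entry f j j ^ k \<le> u k" for k
  proof -
    have "c * entry f j j ^ k \<le> c * entry (f ^^ k) j j"
      using cC diagonal_entry_power_le[OF f] by simp
    also have "\<dots> \<le> c * norm ((f ^^ k) (axis j 1))"
      using cC component_le_norm_cart[of "(f ^^ k) (axis j 1)" j]
      by (intro mult_left_mono) (auto simp: entry_def)
    also have "\<dots> \<le> N ((f ^^ k) (axis j 1))" by (rule low)
    also have "\<dots> \<le> u k * N (axis j 1)"
      unfolding u_def by (rule norm_apply_le_cone_norm[OF N fk axis_in_cone])
    also have "\<dots> \<le> u k * C"
      using up[of "axis j 1"] u0 by (intro mult_left_mono) (simp_all add: norm_axis_1)
    finally show ?thesis using cC by (simp add: field_simps)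
  qed
  have "(\<lambda>k. root k (c / C) * entry f j j) \<longlonglongrightarrow> 1 * entry f j j"
    using cC by (intro tendsto_mult LIMSEQ_root_const tendsto_const) simp
  moreover have "\<forall>\<^sub>F k in sequentially. root k (c / C) * entry f j j \<le> root k (u k)"
    using eventually_gt_at_top[of 0]
  proof eventually_elim
    case (elim k)
    have "root k (c / C) * entry f j j = root k (c / C * entry f j j ^ k)"
      by (simp only: real_root_mult real_root_power_cancel[OF elim entry_nonneg[OF f]])
    also have "\<dots> \<le> root k (u k)" by (rule real_root_le_mono[OF elim ujj])
    finally show ?case .
  qed
  ultimately show ?thesis
    using tendsto_le[OF sequentially_bot lim] by simp
qed

section \<open>Products of maps of the family\<close>

lemma family_power_0: "family_power A 0 = {id}"
  by (auto simp: family_power_def)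

lemma family_power_1: "f \<in> A \<Longrightarrow> f \<in> family_power A 1"
  unfolding family_power_def by (rule CollectI, rule exI[of _ "[f]"]) simp

lemma foldr_comp_append: "foldr (\<circ>) (xs @ ys) id = foldr (\<circ>) xs id \<circ> foldr (\<circ>) ys id"
  by (induction xs) (simp_all add: comp_assoc)

lemma family_power_comp:
  assumes "f \<in> family_power A m" "g \<in> family_power A k"
  shows "f \<circ> g \<in> family_power A (m + k)"
proof -
  obtain xs ys where "f = foldr (\<circ>) xs id" "length xs = m" "set xs \<subseteq> A"
    "g = foldr (\<circ>) ys id" "length ys = k" "set ys \<subseteq> A"
    using assms by (auto simp: family_power_def)
  then show ?thesis
    unfolding family_power_def
    by (intro CollectI exI[of _ "xs @ ys"]) (simp only: foldr_comp_append, simp)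
qed

lemma family_power_funpow: "f \<in> family_power A m \<Longrightarrow> f ^^ k \<in> family_power A (m * k)"
  by (induction k) (auto simp: family_power_0 intro: family_power_comp)

lemma family_power_sublinear:
  assumes "\<And>f. f \<in> A \<Longrightarrow> cone_sublinear f" "f \<in> family_power A m"
  shows "cone_sublinear f"
proof -
  have "cone_sublinear (foldr (\<circ>) fs id)" if "set fs \<subseteq> A" for fs
    using that by (induction fs) (auto intro: sublinear_id sublinear_comp assms(1))
  then show ?thesis using assms(2) by (auto simp: family_power_def)
qed

text \<open>
  A product \<open>f\<close> of \<open>m\<close> maps contributes to the upper limit through its powers: \<open>f\<^sup>k\<close> is a product of
  \<open>m k\<close> maps and \<open>r(f\<^sup>k) \<ge> (f\<^sub>j\<^sub>j)\<^sup>k\<close>, so the terms at all multiples of \<open>m\<close> are at least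
  \<open>root m (f\<^sub>j\<^sub>j)\<close>.
\<close>

lemma root_diagonal_entry_le_generalized_spectral_radius:
  fixes N :: "real ^ 'n \<Rightarrow> real"
  assumes N: "is_norm N" and A: "\<And>f. f \<in> A \<Longrightarrow> cone_sublinear f"
    and m: "0 < m" and f: "f \<in> family_power A m"
  shows "ereal (root m (entry f j j)) \<le> generalized_spectral_radius N A"
  unfolding generalized_spectral_radius_def limsup_INF_SUP
proof (rule INF_greatest)
  fix n :: nat
  let ?k = "Suc n"
  have fs: "cone_sublinear f" by (rule family_power_sublinear[OF A f])
  have "entry f j j ^ ?k \<le> entry (f ^^ ?k) j j"
    by (rule diagonal_entry_power_le[OF fs])
  also have "\<dots> \<le> cone_spectral_radius N (f ^^ ?k)"
    by (rule diagonal_entry_le_spectral_radius[OF N sublinear_funpow[OF fs]])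
  finally have "root (m * ?k) (entry f j j ^ ?k)
      \<le> root (m * ?k) (cone_spectral_radius N (f ^^ ?k))"
    using m by (intro real_root_le_mono) simp_all
  moreover have "root (m * ?k) (entry f j j ^ ?k) = root m (entry f j j)"
    using entry_nonneg[OF fs] by (simp only: real_root_mult_exp real_root_power_cancel zero_less_Suc)
  ultimately have "ereal (root m (entry f j j))
      \<le> ereal (root (m * ?k) (cone_spectral_radius N (f ^^ ?k)))" by simp
  also have "\<dots> \<le> (SUP g\<in>family_power A (m * ?k).
      ereal (root (m * ?k) (cone_spectral_radius N g)))"
    by (rule SUP_upper[OF family_power_funpow[OF f]])
  also have "\<dots> \<le> (SUP l\<in>{n..}. SUP g\<in>family_power A l. ereal (root l (cone_spectral_radius N g)))"
  proof (rule SUP_upper)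
    have "n \<le> 1 * ?k" by simp
    also have "\<dots> \<le> m * ?k" using m by (intro mult_right_mono) auto
    finally show "m * ?k \<in> {n..}" by simp
  qed
  finally show "ereal (root m (entry f j j))
    \<le> (SUP l\<in>{n..}. SUP g\<in>family_power A l. ereal (root l (cone_spectral_radius N g)))" .
qed

section \<open>Faces and irreducibility\<close>

lemma coordinate_subcone_face:
  fixes I :: "'n::finite set"
  defines "F \<equiv> {x \<in> nonneg_cone. \<forall>i. i \<notin> I \<longrightarrow> x $ i = 0} :: (real ^ 'n) set"
  shows "F face_of nonneg_cone" and "closed F"
proof -
  show "F face_of nonneg_cone"
    unfolding face_of_def
  proof (intro conjI ballI impI)
    show "F \<subseteq> nonneg_cone" by (auto simp: F_def)
    show "convex F"
      unfolding F_def by (rule convexI) (simp add: mem_nonneg_cone_iff)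
    fix a b x :: "real ^ 'n"
    assume a: "a \<in> nonneg_cone" and b: "b \<in> nonneg_cone" and x: "x \<in> F" "x \<in> open_segment a b"
    obtain t where t: "0 < t" "t < 1" "x = (1 - t) *\<^sub>R a + t *\<^sub>R b"
      using x(2) by (auto simp: in_segment)
    have "a $ i = 0 \<and> b $ i = 0" if "i \<notin> I" for i
    proof -
      have ab: "0 \<le> a $ i" "0 \<le> b $ i" using a b by (auto simp: mem_nonneg_cone_iff)
      have "(1 - t) * a $ i + t * b $ i = 0" using x(1) that t(3) by (auto simp: F_def)
      then have "(1 - t) * a $ i = 0 \<and> t * b $ i = 0"
        using ab t by (subst (asm) add_nonneg_eq_0_iff) auto
      then show ?thesis using t by auto
    qed
    then show "a \<in> F" "b \<in> F" using a b by (auto simp: F_def)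
  qed
  have "F = (\<Inter>i. {x. 0 \<le> x $ i}) \<inter> (\<Inter>i\<in>-I. {x. x $ i = 0})"
    by (auto simp: F_def mem_nonneg_cone_iff)
  moreover have "closed (\<Inter>i. {x :: real ^ 'n. 0 \<le> x $ i})"
    by (intro closed_INT ballI closed_Collect_le continuous_intros)
  moreover have "closed (\<Inter>i\<in>-I. {x :: real ^ 'n. x $ i = 0})"
    by (intro closed_INT ballI closed_Collect_eq continuous_intros)
  ultimately show "closed F" by auto
qed

text \<open>
  The coordinates \<open>i\<close> for which some product \<open>h\<close> has \<open>h\<^sub>i\<^sub>j > 0\<close> span an invariant face: a positive
  entry \<open>f\<^sub>i\<^sub>k\<close> with \<open>k\<close> reachable makes \<open>i\<close> reachable through \<open>f \<circ> h\<close>. The empty product makes \<open>j\<close>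
  itself reachable, so the face is not \<open>{0}\<close> and must be the whole cone.
\<close>

lemma irreducible_imp_positive_entry:
  fixes A :: "(real ^ 'n \<Rightarrow> real ^ 'n) set"
  assumes A: "\<And>f. f \<in> A \<Longrightarrow> cone_sublinear f" and irr: "irreducible_family A"
  shows "\<exists>m. \<exists>h\<in>family_power A m. 0 < entry h i j"
proof -
  define I where "I = {i. \<exists>m. \<exists>h\<in>family_power A m. 0 < entry h i j}"
  define F where "F = {x \<in> nonneg_cone. \<forall>i. i \<notin> I \<longrightarrow> x $ i = (0::real)}"
  have "j \<in> I"
    unfolding I_def by (intro CollectI exI[of _ 0]) (simp add: family_power_0 entry_def)
  then have "i \<notin> I \<longrightarrow> axis j (1::real) $ i = 0" for i by (auto simp: axis_def)
  then have axF: "axis j 1 \<in> F" by (simp add: F_def axis_in_cone)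
  have inv: "f ` F \<subseteq> F" if f: "f \<in> A" for f
  proof
    fix y assume "y \<in> f ` F"
    then obtain x where x: "x \<in> nonneg_cone" "\<And>i. i \<notin> I \<Longrightarrow> x $ i = 0" and y: "y = f x"
      by (auto simp: F_def)
    note fs = A[OF f]
    have fx: "f x \<in> nonneg_cone" by (rule sublinear_in_cone[OF fs x(1)])
    have "f x $ i = 0" if i: "i \<notin> I" for i
    proof -
      have "x $ k * entry f i k = 0" for k
      proof (cases "k \<in> I")
        case True
        then obtain m h where h: "h \<in> family_power A m" "0 < entry h k j" by (auto simp: I_def)
        have "f \<circ> h \<in> family_power A (1 + m)"
          by (rule family_power_comp[OF family_power_1[OF f] h(1)])
        then have "\<not> 0 < entry (f \<circ> h) i j" using i unfolding I_def by blast
        then have "entry f i k * entry h k j \<le> 0"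
          using entry_mult_le_entry_comp[OF family_power_sublinear[OF A h(1)] fs, of i k j]
          by linarith
        then have "entry f i k \<le> 0" using h(2) by (simp add: mult_le_0_iff)
        then show ?thesis using entry_nonneg[OF fs, of i k] by simp
      next
        case False
        then show ?thesis using x(2) by simp
      qed
      then have "(\<Sum>k\<in>UNIV. x $ k * entry f i k) = 0" by (intro sum.neutral) blast
      then have "f x $ i \<le> 0" using coord_le_sum_entry[OF fs x(1), of i] by simp
      then show ?thesis using fx by (simp add: mem_nonneg_cone_iff order_antisym)
    qed
    then show "y \<in> F" using fx y by (auto simp: F_def)
  qed
  have "F face_of nonneg_cone" "closed F"
    unfolding F_def by (rule coordinate_subcone_face)+
  moreover have "F \<noteq> {}" "F \<noteq> {0}" using axF by (auto simp: axis_eq_0_iff)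
  ultimately have "F = nonneg_cone"
    using irr inv unfolding irreducible_family_def by blast
  then have "axis i 1 \<in> F" using axis_in_cone by simp
  then have "i \<in> I" by (auto simp: F_def axis_def)
  then show ?thesis by (simp add: I_def)
qed

section \<open>Boundedness of the semigroup\<close>

theorem theorem4p3:
  fixes N :: "real ^ 'n \<Rightarrow> real"
    and A :: "(real ^ 'n \<Rightarrow> real ^ 'n) set"
  assumes "is_norm N"
    and "\<And>f. f \<in> A \<Longrightarrow> cone_self_map f"
    and "\<And>f. f \<in> A \<Longrightarrow> cone_subadditive f"
    and "\<And>f. f \<in> A \<Longrightarrow> cone_order_preserving f"
    and "\<And>f. f \<in> A \<Longrightarrow> cone_homogeneous f"
    and "bounded_family N A"
    and "irreducible_family A"
    and "generalized_spectral_radius N A = 1"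
  shows "bounded_family N (generated_semigroup A)"
proof -
  note N = assms(1)
  have A: "cone_sublinear f" if "f \<in> A" for f
    using that assms(2-5) by (simp add: cone_sublinear_def)
  obtain d h where h: "\<And>i j. h i j \<in> family_power A (d i j)" "\<And>i j. 0 < entry (h i j) i j"
    using irreducible_imp_positive_entry[OF A assms(7)] by metis
  define M where "M = (\<Sum>i\<in>UNIV. \<Sum>j\<in>UNIV. 1 / entry (h i j) i j)"
  have hM: "1 / entry (h i j) i j \<le> M" for i j
  proof -
    have pos: "0 \<le> 1 / entry (h i j) i j" for i j using h(2)[of i j] by simp
    have "1 / entry (h i j) i j \<le> (\<Sum>j\<in>UNIV. 1 / entry (h i j) i j)"
      by (rule member_le_sum) (use pos in auto)
    also have "\<dots> \<le> M"
      unfolding M_def by (rule member_le_sum) (use pos in \<open>auto intro!: sum_nonneg\<close>)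
    finally show ?thesis .
  qed
  obtain K where K: "\<And>f M. cone_sublinear f \<Longrightarrow> (\<And>i j. entry f i j \<le> M) \<Longrightarrow>
      cone_norm N f \<le> ereal (K * M)"
    by (rule cone_norm_le_entries[OF N]) blast
  have "cone_norm N f \<le> ereal (K * M)" if f: "f \<in> generated_semigroup A" for f
  proof -
    obtain m where m: "0 < m" "f \<in> family_power A m"
      using f by (auto simp: generated_semigroup_def)
    have fs: "cone_sublinear f" by (rule family_power_sublinear[OF A m(2)])
    have "entry f i j \<le> M" for i j
    proof -
      \<comment> \<open>Return from \<open>i\<close> to \<open>j\<close>, so that the entry \<open>f\<^sub>i\<^sub>j\<close> becomes visible on the diagonal.\<close>
      let ?g = "h j i \<circ> f"
      have g: "?g \<in> family_power A (d j i + m)" by (rule family_power_comp[OF h(1) m(2)])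
      have "ereal (root (d j i + m) (entry ?g j j)) \<le> 1"
        using root_diagonal_entry_le_generalized_spectral_radius[OF N A _ g, of j] m(1) assms(8)
        by simp
      then have "entry ?g j j \<le> 1"
        using m(1) by (simp add: one_ereal_def)
      moreover have "cone_sublinear (h j i)" by (rule family_power_sublinear[OF A h(1)])
      ultimately have "entry (h j i) j i * entry f i j \<le> 1"
        using entry_mult_le_entry_comp[OF fs, of "h j i" j i j] by linarith
      then have "entry f i j \<le> 1 / entry (h j i) j i"
        using h(2)[of j i] by (simp add: field_simps)
      then show ?thesis using hM[of j i] by linarith
    qed
    then show ?thesis by (rule K[OF fs])
  qed
  then show ?thesis unfolding bounded_family_def by blast
qed

end
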